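(* Let $G=(V_G,E_G)$ and $H=(V_H,E_H)$ be finite simple connected graphs with $V_G=\{x_1,\ldots,x_n\}$, $n\ge2$, and $|V_H|\ge 2$. Then, identifying the vertex $(y_1,\ldots,y_n)x$ of $G\wr H$ with the vertex $(y_1,\ldots,y_n,x)$ of $A(H)^{\times n}\times A_{Ha}(G)$, $$A(G\wr H)=A(H)^{\times n}\times A_{Ha}(G).$$
   Context: The wreath product $G\wr H$ has vertex set $\{(f,v): f:V_G\to V_H,\ v\in V_G\}$; $(f,v)$ and $(f',v')$ are adjacent iff either $v=v'$, $f(w)=f'(w)$ for $w\neq v$ and $f(v)\sim f'(v)$ in $H$, or $f=f'$ and $v\sim v'$ in $G$; the vertex $(f,x_i)$ is written $(y_1,\ldots,y_n)x_i$ with $y_j=f(x_j)$. For a connected graph $X$, the antipodal graph $A(X)$ has vertex set $V_X$, with $u\sim v$ iff $d_X(u,v)=diam(X)$ ($d_X$ the geodesic distance). For $u,v\in V_G$, $d_{Ha}(u,v)$ is the minimum length of a walk in $G$ from $u$ to $v$ (vertex repetitions allowed) visiting every vertex of $G$; $diam_{Ha}(G)=\max_{u,v}d_{Ha}(u,v)$; the Hamiltonian antipodal graph $A_{Ha}(G)$ has vertex set $V_G$, with $u$ and $v$ (possibly $u=v$, giving a loop) adjacent iff $d_{Ha}(u,v)=diam_{Ha}(G)$. The direct product $X\times Y$ of graphs (loops allowed) has vertex set $V_X\times V_Y$, with $(a,b)\sim(a',b')$ iff $a\sim a'$ in $X$ and $b\sim b'$ in $Y$ (where a loop at $a$ means $a\sim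 a$); $X^{\times n}$ is the $n$-fold direct power. *)

theory Defs
  imports "Graph_Theory.Graph_Theory" "HOL-Library.FuncSet"
begin

text \<open>
  Undirected graphs are symmetric digraphs whose arcs are pairs of vertices; a loop at a vertex
  v is the arc (v, v). A finite simple graph is a \<^locale>\<open>pair_graph\<close>.
\<close>

definition geodesic_dist :: "'a pair_pre_digraph \<Rightarrow> 'a \<Rightarrow> 'a \<Rightarrow> nat" where
  "geodesic_dist X u v = (LEAST k. \<exists>p. pre_digraph.awalk X u p v \<and> length p = k)"

definition graph_diam :: "'a pair_pre_digraph \<Rightarrow> nat" where
  "graph_diam X = Max {geodesic_dist X u v | u v. u \<in> pverts X \<and> v \<in> pverts X}"

definition antipodal_graph :: "'a pair_pre_digraph \<Rightarrow> 'a pair_pre_digraph" where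
  "antipodal_graph X = \<lparr> pverts = pverts X,
     parcs = {(u, v). u \<in> pverts X \<and> v \<in> pverts X \<and> geodesic_dist X u v = graph_diam X} \<rparr>"

definition ham_dist :: "'a pair_pre_digraph \<Rightarrow> 'a \<Rightarrow> 'a \<Rightarrow> nat" where
  "ham_dist G u v = (LEAST k. \<exists>p. pre_digraph.awalk G u p v \<and>
     pverts G \<subseteq> set (pre_digraph.awalk_verts G u p) \<and> length p = k)"

definition ham_diam :: "'a pair_pre_digraph \<Rightarrow> nat" where
  "ham_diam G = Max {ham_dist G u v | u v. u \<in> pverts G \<and> v \<in> pverts G}"

definition ham_antipodal_graph :: "'a pair_pre_digraph \<Rightarrow> 'a pair_pre_digraph" where
  "ham_antipodal_graph G = \<lparr> pverts = pverts G,
     parcs = {(u, v). u \<in> pverts G \<and> v \<in> pverts G \<and> ham_dist G u v = ham_diam G} \<rparr>"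

text \<open>
  Maps from the vertices of G to those of H are represented by extensional functions, so that
  equality of such maps is equality in the logic.
\<close>

definition wreath_product ::
    "'a pair_pre_digraph \<Rightarrow> 'b pair_pre_digraph \<Rightarrow> (('a \<Rightarrow> 'b) \<times> 'a) pair_pre_digraph" where
  "wreath_product G H = \<lparr> pverts = (pverts G \<rightarrow>\<^sub>E pverts H) \<times> pverts G,
     parcs = {((f, v), (f', v')).
       f \<in> pverts G \<rightarrow>\<^sub>E pverts H \<and> v \<in> pverts G \<and>
       f' \<in> pverts G \<rightarrow>\<^sub>E pverts H \<and> v' \<in> pverts G \<and>
       (v = v' \<and> (\<forall>w \<in> pverts G. w \<noteq> v \<longrightarrow> f w = f' w) \<and> (f v, f' v) \<in> parcs H \<or>
        f = f' \<and> (v, v') \<in> parcs G)} \<rparr>"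

definition direct_product ::
    "'a pair_pre_digraph \<Rightarrow> 'b pair_pre_digraph \<Rightarrow> ('a \<times> 'b) pair_pre_digraph" where
  "direct_product X Y = \<lparr> pverts = pverts X \<times> pverts Y,
     parcs = {((a, b), (a', b')). (a, a') \<in> parcs X \<and> (b, b') \<in> parcs Y} \<rparr>"

text \<open>The vertices of the n-fold direct power are n-tuples, represented by lists of length n.\<close>

definition direct_power :: "'a pair_pre_digraph \<Rightarrow> nat \<Rightarrow> 'a list pair_pre_digraph" where
  "direct_power X n = \<lparr> pverts = {ys. length ys = n \<and> set ys \<subseteq> pverts X},
     parcs = {(ys, zs). length ys = n \<and> length zs = n \<and>
       (\<forall>i < n. (ys ! i, zs ! i) \<in> parcs X)} \<rparr>"

definition relabel :: "('a \<Rightarrow> 'b) \<Rightarrow> 'a pair_pre_digraph \<Rightarrow> 'b pair_pre_digraph" where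
  "relabel h X = \<lparr> pverts = h ` pverts X, parcs = map_prod h h ` parcs X \<rparr>"

text \<open>
  For an enumeration xs of the vertices of G, the vertex (f, x) of the wreath product is
  identified with ((f x1, ..., f xn), x), where xs = [x1, ..., xn].
\<close>

definition wreath_ident :: "'a list \<Rightarrow> ('a \<Rightarrow> 'b) \<times> 'a \<Rightarrow> 'b list \<times> 'a" where
  "wreath_ident xs = (\<lambda>(f, x). (map f xs, x))"

lemma geodesic_dist_eq_mu:
  assumes "pair_wf_digraph X" and "u \<rightarrow>\<^sup>*\<^bsub>X\<^esub> v"
  shows "ereal (geodesic_dist X u v) = wf_digraph.\<mu> X (\<lambda>_. 1) u v"
proof -
  interpret pair_wf_digraph X by fact
  have cost: "awalk_cost (\<lambda>_. 1) p = real (length p)" for p :: "('a \<times> 'a) list"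
    by (induct p) auto
  obtain p where "awalk u p v" using assms(2) by (auto simp: reachable_awalk)
  then have "\<exists>q. awalk u q v \<and> length q = geodesic_dist X u v"
    unfolding geodesic_dist_def by (intro LeastI_ex[of "\<lambda>k. \<exists>p. awalk u p v \<and> length p = k"]) blast
  then obtain q where q: "awalk u q v" "length q = geodesic_dist X u v" by blast
  have "geodesic_dist X u v \<le> length r" if "awalk u r v" for r
    unfolding geodesic_dist_def using that by (intro Least_le) blast
  then show ?thesis
    unfolding \<mu>_def using q
    by (intro antisym INF_greatest INF_lower2[of q]) (auto simp: cost)
qed

end

theory Submission
  imports Defs
begin

text \<open>
  Every move in the wreath product either moves the lamplighter along an arc of G or changes the
  lamp at its current position along an arc of H. A walk from (f, u) to (f', v) therefore costs
  at least the sum of the distances between f w and f' w plus the length of a walk in G from u to v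
  through all w with f w different from f' w, and walking along any such walk in G while
  adjusting each lamp optimally attains this. Hence the distance is at most the sum of lamp distances
  plus the Hamiltonian distance from u to v, with equality if f and f' differ everywhere.
  Both summands can be maximised independently, and as H has positive diameter, pairs with all
  lamp distances maximal differ everywhere.
\<close>

section \<open>Walks that realise the geodesic and the Hamiltonian distance\<close>

context pair_wf_digraph
begin

lemma geodesic_dist_le: "awalk u p v \<Longrightarrow> geodesic_dist G u v \<le> length p"
  unfolding geodesic_dist_def by (intro Least_le) blast

text \<open>\<open>LEAST\<close> denotes an attained length only if some walk exists, so the
  assumption supplies one. The same holds for \<open>ham_dist_walk\<close> and covering
  walks.\<close>

lemma geodesic_dist_walk:
  assumes "awalk u p v"
  obtains q where "awalk u q v" "length q = geodesic_dist G u v"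
proof -
  have "\<exists>q. awalk u q v \<and> length q = geodesic_dist G u v"
    unfolding geodesic_dist_def
    by (intro LeastI_ex[of "\<lambda>k. \<exists>p. awalk u p v \<and> length p = k"]) (use assms in blast)
  then show thesis using that by blast
qed

lemma geodesic_dist_refl [simp]: "u \<in> pverts G \<Longrightarrow> geodesic_dist G u u = 0"
  using geodesic_dist_le[of u "[]" u] by (simp add: awalk_Nil_iff)

lemma ham_dist_le:
  assumes "awalk u p v" "pverts G \<subseteq> set (pawalk_verts u p)"
  shows "ham_dist G u v \<le> length p"
  unfolding ham_dist_def by (rule Least_le) (use assms in auto)

lemma ham_dist_walk:
  assumes "awalk u p v" "pverts G \<subseteq> set (pawalk_verts u p)"
  obtains q where "awalk u q v" "pverts G \<subseteq> set (pawalk_verts u q)" "length q = ham_dist G u v"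
proof -
  have "\<exists>q. awalk u q v \<and> pverts G \<subseteq> set (pawalk_verts u q) \<and> length q = ham_dist G u v"
    unfolding ham_dist_def awalk_verts_with_proj_eq
    by (intro LeastI_ex[of "\<lambda>k. \<exists>p. awalk u p v \<and> pverts G \<subseteq> set (pawalk_verts u p) \<and> length p = k"])
      (use assms in blast)
  then show thesis using that by blast
qed

end

section \<open>Existence of walks and covering walks in connected graphs\<close>

locale connected_pair_graph = pair_graph +
  assumes connected: "connected G"
begin

lemma walk_exists:
  assumes "u \<in> pverts G" "v \<in> pverts G"
  obtains p where "awalk u p v"
proof -
  \<comment> \<open>\<open>connected\<close> speaks of the symmetric closure. Since the arcs of
    \<open>G\<close> are already symmetric, reachability there is reachability in
    \<open>G\<close>.\<close>
  have "u \<rightarrow>\<^sup>*\<^bsub>mk_symmetric G\<^esub> v"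
    using connected assms by (auto simp: connected_def strongly_connected_def)
  then show thesis
    using reachable_mk_symmetric_eq[OF pair_sym_arcs] reachable_awalk that by blast
qed

text \<open>Prepending the arc to a shortest walk from \<open>x\<close> gives the bound. It is later
  applied to the lamp graph: one lamp change lowers the remaining distance by at most one.\<close>

lemma geodesic_dist_arc_le:
  assumes "(u, x) \<in> parcs G" "v \<in> pverts G"
  shows "geodesic_dist G u v \<le> Suc (geodesic_dist G x v)"
proof -
  have "x \<in> pverts G" using assms(1) arc_snd_in_verts by fastforce
  then obtain p where "awalk x p v" using walk_exists assms(2) by blast
  then obtain q where q: "awalk x q v" "length q = geodesic_dist G x v"
    using geodesic_dist_walk by blast
  then have "awalk u ((u, x) # q) v" using assms by (simp add: awalk_Cons_iff)
  then show ?thesis using geodesic_dist_le[of u "(u, x) # q" v] q(2) by simp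
qed

text \<open>Induction on the set of vertices to be visited, with the start left arbitrary: walk from
  \<open>u\<close> to a new vertex \<open>x\<close>, then continue from \<open>x\<close> through the
  remaining ones.\<close>

lemma covering_walk_exists:
  assumes "u \<in> pverts G" "v \<in> pverts G"
  obtains p where "awalk u p v" "pverts G \<subseteq> set (pawalk_verts u p)"
proof -
  have "\<exists>p. awalk u p v \<and> S \<subseteq> set (pawalk_verts u p)" if "finite S" "S \<subseteq> pverts G" for S
    using that assms(1)
  proof (induction S arbitrary: u rule: finite_induct)
    case empty
    then obtain p where "awalk u p v" using walk_exists assms(2) by blast
    then show ?case by auto
  next
    case (insert x S)
    then obtain p where p: "awalk x p v" "S \<subseteq> set (pawalk_verts x p)" by auto
    obtain q where q: "awalk u q x" using walk_exists insert.prems by blast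
    have "x \<in> set (pawalk_verts x p)" by (cases p) (use p(1) in \<open>auto simp: awalk_Cons_iff\<close>)
    then show ?case using p q set_awalk_verts_append[OF q p(1)] awalk_appendI[OF q p(1)]
      by (intro exI[of _ "q @ p"]) auto
  qed
  from this[of "pverts G"] show thesis using that pair_finite_verts by blast
qed

lemma ham_dist_covering_walk:
  assumes "u \<in> pverts G" "v \<in> pverts G"
  obtains q where "awalk u q v" "pverts G \<subseteq> set (pawalk_verts u q)" "length q = ham_dist G u v"
proof -
  obtain p where "awalk u p v" "pverts G \<subseteq> set (pawalk_verts u p)"
    using covering_walk_exists[OF assms] .
  then show thesis using ham_dist_walk that by blast
qed

end

section \<open>Both diameters as attained maxima over pairs of vertices\<close>

lemma Max_pairs:
  fixes d :: "'a \<Rightarrow> 'a \<Rightarrow> nat"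
  assumes "finite V"
  shows Max_pairs_ge: "u \<in> V \<Longrightarrow> v \<in> V \<Longrightarrow> d u v \<le> Max {d u v | u v. u \<in> V \<and> v \<in> V}"
    and Max_pairs_attained:
      "V \<noteq> {} \<Longrightarrow> \<exists>u\<in>V. \<exists>v\<in>V. d u v = Max {d u v | u v. u \<in> V \<and> v \<in> V}"
proof -
  let ?D = "{d u v | u v. u \<in> V \<and> v \<in> V}"
  have "?D = (\<lambda>(u, v). d u v) ` (V \<times> V)" by auto
  then have fin: "finite ?D" using assms by simp
  show "u \<in> V \<Longrightarrow> v \<in> V \<Longrightarrow> d u v \<le> Max ?D" using fin by (intro Max_ge) auto
  assume "V \<noteq> {}"
  then have "Max ?D \<in> ?D" using fin by (intro Max_in) auto
  then show "\<exists>u\<in>V. \<exists>v\<in>V. d u v = Max ?D" unfolding mem_Collect_eq by metis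
qed

lemma graph_diam_ge:
  "\<lbrakk>finite (pverts X); u \<in> pverts X; v \<in> pverts X\<rbrakk> \<Longrightarrow> geodesic_dist X u v \<le> graph_diam X"
  unfolding graph_diam_def by (rule Max_pairs_ge)

lemma graph_diam_attained:
  assumes "finite (pverts X)" "pverts X \<noteq> {}"
  obtains u v where "u \<in> pverts X" "v \<in> pverts X" "geodesic_dist X u v = graph_diam X"
  using Max_pairs_attained[OF assms] unfolding graph_diam_def by blast

lemma ham_diam_ge:
  "\<lbrakk>finite (pverts X); u \<in> pverts X; v \<in> pverts X\<rbrakk> \<Longrightarrow> ham_dist X u v \<le> ham_diam X"
  unfolding ham_diam_def by (rule Max_pairs_ge)

lemma ham_diam_attained:
  assumes "finite (pverts X)" "pverts X \<noteq> {}"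
  obtains u v where "u \<in> pverts X" "v \<in> pverts X" "ham_dist X u v = ham_diam X"
  using Max_pairs_attained[OF assms] unfolding ham_diam_def by blast

text \<open>Positivity guarantees that vertices at maximal distance are distinct, so antipodal lamp
  states really differ.\<close>

lemma (in connected_pair_graph) graph_diam_pos:
  assumes "card (pverts G) \<ge> 2"
  shows "graph_diam G > 0"
proof -
  obtain u v where uv: "u \<in> pverts G" "v \<in> pverts G" "u \<noteq> v"
    using assms card_le_Suc0_iff_eq[OF pair_finite_verts] by fastforce
  then obtain p where "awalk u p v" using walk_exists by blast
  then obtain q where "awalk u q v" "length q = geodesic_dist G u v"
    using geodesic_dist_walk by blast
  then have "geodesic_dist G u v > 0" using uv(3) by (cases q) (auto simp: awalk_Nil_iff)
  then show ?thesis using graph_diam_ge[OF pair_finite_verts uv(1,2)] by linarith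
qed

section \<open>Translation between walks in the wreath product and walks in its factors\<close>

locale wreath_factors = G: connected_pair_graph G + H: connected_pair_graph H
  for G :: "'a pair_pre_digraph" and H :: "'b pair_pre_digraph"
begin

abbreviation "states \<equiv> pverts G \<rightarrow>\<^sub>E pverts H"

abbreviation "lamp_dist f f' \<equiv> \<Sum>w\<in>pverts G. geodesic_dist H (f w) (f' w)"

lemma pverts_wreath [simp]: "pverts (wreath_product G H) = states \<times> pverts G"
  by (simp add: wreath_product_def)

lemma parcs_wreath:
  "((f, v), (f', v')) \<in> parcs (wreath_product G H) \<longleftrightarrow>
    f \<in> states \<and> v \<in> pverts G \<and> f' \<in> states \<and> v' \<in> pverts G \<and>
    (v = v' \<and> (\<forall>w\<in>pverts G. w \<noteq> v \<longrightarrow> f w = f' w) \<and> (f v, f' v) \<in> parcs H \<or>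
      f = f' \<and> (v, v') \<in> parcs G)"
  by (simp add: wreath_product_def)

sublocale W: pair_wf_digraph "wreath_product G H"
  by unfold_locales (auto simp: wreath_product_def)

lemma finite_states: "finite states"
  using G.pair_finite_verts H.pair_finite_verts by (intro finite_PiE) auto

text \<open>A walk in \<open>H\<close> lifts to a sequence of lamp changes at the fixed position
  \<open>u\<close>; each later update at \<open>u\<close> overwrites the earlier one.\<close>

lemma lamp_walk:
  assumes "H.awalk (f u) r y" "f \<in> states" "u \<in> pverts G"
  shows "\<exists>p. W.awalk (f, u) p (f(u := y), u) \<and> length p = length r"
  using assms
proof (induction r arbitrary: f)
  case Nil
  then have "f(u := y) = f" by (auto simp: H.awalk_Nil_iff)
  then show ?case using Nil by (intro exI[of _ "[]"]) (simp add: W.awalk_Nil_iff)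
next
  case (Cons e r)
  obtain z where e: "e = (f u, z)" "(f u, z) \<in> parcs H" and r: "H.awalk z r y"
    using Cons.prems(1) by (cases e) (auto simp: H.awalk_Cons_iff)
  let ?g = "f(u := z)"
  have "z \<in> pverts H" using e(2) H.arc_snd_in_verts by fastforce
  then have g: "?g \<in> states" using Cons.prems by (auto simp: PiE_iff extensional_def)
  have "\<exists>p. W.awalk (?g, u) p (?g(u := y), u) \<and> length p = length r"
    by (rule Cons.IH[OF _ g Cons.prems(3)]) (simp add: r)
  then obtain p where p: "W.awalk (?g, u) p (f(u := y), u)" "length p = length r"
    by auto
  have "((f, u), (?g, u)) \<in> parcs (wreath_product G H)"
    using Cons.prems g e(2) by (simp add: parcs_wreath)
  then show ?case using p
    by (intro exI[of _ "((f, u), (?g, u)) # p"]) (simp add: W.awalk_Cons_iff del: fun_upd_apply)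
qed

lemma lamp_walk_geodesic:
  assumes "f \<in> states" "u \<in> pverts G" "y \<in> pverts H"
  obtains p where "W.awalk (f, u) p (f(u := y), u)" "length p = geodesic_dist H (f u) y"
proof -
  have "f u \<in> pverts H" using assms by auto
  then obtain r where "H.awalk (f u) r y" "length r = geodesic_dist H (f u) y"
    using H.walk_exists[OF _ assms(3)] H.geodesic_dist_walk by metis
  then show thesis using lamp_walk[of f u r y] assms that by auto
qed

text \<open>Only the summand at \<open>u\<close> can differ. The additive form avoids truncated
  subtraction on the naturals.\<close>

lemma lamp_dist_update:
  assumes "u \<in> pverts G" "\<forall>w\<in>pverts G. w \<noteq> u \<longrightarrow> g w = f w"
  shows "lamp_dist f f' + geodesic_dist H (g u) (f' u) =
    lamp_dist g f' + geodesic_dist H (f u) (f' u)"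
proof -
  have "(\<Sum>w\<in>pverts G - {u}. geodesic_dist H (f w) (f' w)) =
      (\<Sum>w\<in>pverts G - {u}. geodesic_dist H (g w) (f' w))"
    using assms(2) by (intro sum.cong) auto
  then show ?thesis using G.pair_finite_verts assms(1) by (simp add: sum.remove)
qed

text \<open>Each lamp is set to its final state when its vertex is first visited; a later visit then
  costs nothing. Requiring visits only where \<open>f\<close> and \<open>f'\<close> differ keeps the
  hypothesis valid for the tail of the walk.\<close>

lemma wreath_walk_of_walk:
  assumes "G.awalk u q v" "f \<in> states" "f' \<in> states"
    and "\<forall>w\<in>pverts G. f w \<noteq> f' w \<longrightarrow> w \<in> set (pawalk_verts u q)"
  shows "\<exists>p. W.awalk (f, u) p (f', v) \<and> length p = length q + lamp_dist f f'"
  using assms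
proof (induction q arbitrary: u f)
  case Nil
  then have u: "v = u" "u \<in> pverts G" by (auto simp: G.awalk_Nil_iff)
  \<comment> \<open>The trivial walk visits only \<open>u\<close>, so all other lamps are already
    correct.\<close>
  have same: "f w = f' w" if "w \<in> pverts G" "w \<noteq> u" for w
    using Nil.prems(4)[rule_format, OF that(1)] that(2) by fastforce
  \<comment> \<open>Outside \<open>pverts G\<close> the two maps agree because both are
    extensional.\<close>
  have eq: "f(u := f' u) = f'"
  proof
    fix w show "(f(u := f' u)) w = f' w"
      by (cases "w \<in> pverts G")
        (use u(2) in \<open>auto simp: same PiE_arb[OF Nil.prems(2)] PiE_arb[OF Nil.prems(3)]\<close>)
  qed
  have "f' u \<in> pverts H" using PiE_mem[OF Nil.prems(3) u(2)] .
  then obtain p where p: "W.awalk (f, u) p (f', u)" "length p = geodesic_dist H (f u) (f' u)"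
    using lamp_walk_geodesic[OF Nil.prems(2) u(2), of "f' u"] unfolding eq by blast
  \<comment> \<open>With \<open>f'\<close> as the updated map, \<open>lamp_dist_update\<close>
    leaves the summand at \<open>u\<close> alone, as the two other terms vanish.\<close>
  have "lamp_dist f' f' = 0" using Nil.prems(3) by (auto simp: PiE_iff)
  moreover have "geodesic_dist H (f' u) (f' u) = 0" using \<open>f' u \<in> pverts H\<close> by simp
  ultimately have "lamp_dist f f' = geodesic_dist H (f u) (f' u)"
    using lamp_dist_update[of u f' f f'] u(2) same by fastforce
  then show ?case using p u by auto
next
  case (Cons e q)
  obtain x where e: "e = (u, x)" "(u, x) \<in> parcs G" and q: "G.awalk x q v"
    using Cons.prems(1) by (cases e) (auto simp: G.awalk_Cons_iff)
  let ?g = "f(u := f' u)"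
  have u: "u \<in> pverts G" and x: "x \<in> pverts G"
    using e(2) G.arc_fst_in_verts G.arc_snd_in_verts by fastforce+
  then have fu: "f' u \<in> pverts H" using PiE_mem[OF Cons.prems(3)] by simp
  then have g: "?g \<in> states" using Cons.prems(2) u by (auto simp: PiE_iff extensional_def)
  \<comment> \<open>A lamp still wrong after the repair at \<open>u\<close> belongs to another
    vertex, which the walk must therefore meet after its first entry.\<close>
  have "\<forall>w\<in>pverts G. ?g w \<noteq> f' w \<longrightarrow> w \<in> set (pawalk_verts x q)"
  proof (intro ballI impI)
    fix w assume w: "w \<in> pverts G" "?g w \<noteq> f' w"
    then have "w \<noteq> u" "f w \<noteq> f' w" by (auto split: if_splits)
    then show "w \<in> set (pawalk_verts x q)"
      using Cons.prems(4)[rule_format, OF w(1)] e(1) by simp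
  qed
  then obtain p where p: "W.awalk (?g, x) p (f', v)" "length p = length q + lamp_dist ?g f'"
    using Cons.IH[OF q g Cons.prems(3)] by blast
  obtain r where r: "W.awalk (f, u) r (?g, u)" "length r = geodesic_dist H (f u) (f' u)"
    using lamp_walk_geodesic[OF Cons.prems(2) u fu] by blast
  have "((?g, u), (?g, x)) \<in> parcs (wreath_product G H)"
    using g u x e(2) by (simp add: parcs_wreath)
  then have "W.awalk (?g, u) (((?g, u), (?g, x)) # p) (f', v)"
    using p(1) by (simp add: W.awalk_Cons_iff)
  then have "W.awalk (f, u) (r @ ((?g, u), (?g, x)) # p) (f', v)"
    using r(1) W.awalk_appendI by blast
  moreover have "lamp_dist f f' = lamp_dist ?g f' + geodesic_dist H (f u) (f' u)"
    using lamp_dist_update[of u ?g f f'] u fu by auto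
  ultimately show ?case using p(2) r(2)
    by (intro exI[of _ "r @ ((?g, u), (?g, x)) # p"]) simp
qed

text \<open>Projecting to positions drops the lamp moves. Each dropped move pays for a decrease of
  at most one in \<open>lamp_dist\<close>, and a lamp can change only at a position on the projected
  walk.\<close>

lemma walk_of_wreath_walk:
  assumes "W.awalk (f, u) p (f', v)"
  shows "\<exists>q. G.awalk u q v \<and> (\<forall>w\<in>pverts G. f w \<noteq> f' w \<longrightarrow> w \<in> set (pawalk_verts u q)) \<and>
    length q + lamp_dist f f' \<le> length p"
  using assms
proof (induction p arbitrary: f u)
  case Nil
  then have "f = f'" "u = v" "f \<in> states" "u \<in> pverts G" by (auto simp: W.awalk_Nil_iff)
  then show ?case by (intro exI[of _ "[]"]) (auto simp: G.awalk_Nil_iff PiE_iff)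
next
  case (Cons e p)
  obtain g x where e: "((f, u), (g, x)) \<in> parcs (wreath_product G H)"
    and p: "W.awalk (g, x) p (f', v)"
    using Cons.prems by (cases e) (auto simp: W.awalk_Cons_iff)
  obtain q where q: "G.awalk x q v"
      "\<forall>w\<in>pverts G. g w \<noteq> f' w \<longrightarrow> w \<in> set (pawalk_verts x q)"
      "length q + lamp_dist g f' \<le> length p"
    using Cons.IH[OF p] by blast
  have u: "u \<in> pverts G" using e by (simp add: parcs_wreath)
  consider "u = x" "\<forall>w\<in>pverts G. w \<noteq> u \<longrightarrow> f w = g w" "(f u, g u) \<in> parcs H"
    | "f = g" "(u, x) \<in> parcs G"
    using e by (auto simp: parcs_wreath)
  then show ?case
  proof cases
    case 1
    have "(f', v) \<in> states \<times> pverts G" using p W.awalk_last_in_verts[OF p] by simp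
    then have "f' u \<in> pverts H" using u by auto
    then have "lamp_dist f f' \<le> Suc (lamp_dist g f')"
      using H.geodesic_dist_arc_le[OF 1(3)] lamp_dist_update[of u g f f'] u 1(2) by fastforce
    \<comment> \<open>A lamp move keeps the walk \<open>q\<close>. The lamp at \<open>u\<close> may
      now count as different, but \<open>u\<close> is the start of \<open>q\<close>.\<close>
    moreover have "u \<in> set (pawalk_verts u q)"
      using q(1) 1(1) by (cases q) (auto simp: G.awalk_Cons_iff)
    ultimately show ?thesis using q 1 by (intro exI[of _ q]) auto
  next
    case 2
    then show ?thesis using q
      by (intro exI[of _ "(u, x) # q"]) (auto simp: G.awalk_Cons_iff)
  qed
qed

section \<open>Distances in the wreath product\<close>

lemma wreath_dist_le:
  assumes "f \<in> states" "f' \<in> states" "u \<in> pverts G" "v \<in> pverts G"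
  shows "geodesic_dist (wreath_product G H) (f, u) (f', v) \<le> lamp_dist f f' + ham_dist G u v"
proof -
  obtain q where q: "G.awalk u q v" "pverts G \<subseteq> set (pawalk_verts u q)"
      "length q = ham_dist G u v"
    using G.ham_dist_covering_walk[OF assms(3,4)] by blast
  then obtain p where "W.awalk (f, u) p (f', v)" "length p = length q + lamp_dist f f'"
    using wreath_walk_of_walk[OF q(1) assms(1,2)] by blast
  then show ?thesis using W.geodesic_dist_le[of "(f, u)" p "(f', v)"] q(3) by simp
qed

text \<open>If every lamp has to change, the projection of a shortest walk visits all of
  \<open>G\<close>, so its length is at least \<open>ham_dist G u v\<close>.\<close>

lemma wreath_dist_eq:
  assumes "f \<in> states" "f' \<in> states" "u \<in> pverts G" "v \<in> pverts G"
    and "\<forall>w\<in>pverts G. f w \<noteq> f' w"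
  shows "geodesic_dist (wreath_product G H) (f, u) (f', v) = lamp_dist f f' + ham_dist G u v"
proof (rule antisym[OF wreath_dist_le[OF assms(1-4)]])
  \<comment> \<open>This walk serves only to show that the endpoints are joined in the wreath
    product, so that a shortest walk \<open>r\<close> exists.\<close>
  obtain q where q: "G.awalk u q v" "pverts G \<subseteq> set (pawalk_verts u q)"
    using G.covering_walk_exists[OF assms(3,4)] by blast
  then obtain p where "W.awalk (f, u) p (f', v)"
    using wreath_walk_of_walk[OF q(1) assms(1,2)] by blast
  then obtain r where r: "W.awalk (f, u) r (f', v)"
      "length r = geodesic_dist (wreath_product G H) (f, u) (f', v)"
    using W.geodesic_dist_walk by blast
  then obtain s where s: "G.awalk u s v" "\<forall>w\<in>pverts G. w \<in> set (pawalk_verts u s)"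
      "length s + lamp_dist f f' \<le> length r"
    using walk_of_wreath_walk[OF r(1)] assms(5) by blast
  then show "lamp_dist f f' + ham_dist G u v \<le>
      geodesic_dist (wreath_product G H) (f, u) (f', v)"
    using G.ham_dist_le[OF s(1)] r(2) by fastforce
qed

section \<open>Diameter and antipodal pairs of the wreath product\<close>

lemma lamp_dist_le:
  assumes "f \<in> states" "f' \<in> states"
  shows "lamp_dist f f' \<le> card (pverts G) * graph_diam H"
  using sum_bounded_above[of "pverts G" "\<lambda>w. geodesic_dist H (f w) (f' w)" "graph_diam H"]
    assms graph_diam_ge[OF H.pair_finite_verts] by (auto simp: PiE_iff)

text \<open>A sum of terms bounded by a common value reaches its maximum exactly when every term
  does.\<close>

lemma lamp_dist_eq_iff:
  assumes "f \<in> states" "f' \<in> states"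
  shows "lamp_dist f f' = card (pverts G) * graph_diam H \<longleftrightarrow>
    (\<forall>w\<in>pverts G. geodesic_dist H (f w) (f' w) = graph_diam H)"
proof
  assume "\<forall>w\<in>pverts G. geodesic_dist H (f w) (f' w) = graph_diam H"
  then show "lamp_dist f f' = card (pverts G) * graph_diam H" by simp
next
  assume eq: "lamp_dist f f' = card (pverts G) * graph_diam H"
  have le: "geodesic_dist H (f w) (f' w) \<le> graph_diam H" if "w \<in> pverts G" for w
    using that assms graph_diam_ge[OF H.pair_finite_verts] by (auto simp: PiE_iff)
  show "\<forall>w\<in>pverts G. geodesic_dist H (f w) (f' w) = graph_diam H"
  proof (rule ccontr)
    assume "\<not> ?thesis"
    then obtain w where w: "w \<in> pverts G" "geodesic_dist H (f w) (f' w) < graph_diam H"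
      using le le_neq_implies_less by blast
    then have "lamp_dist f f' < (\<Sum>w\<in>pverts G. graph_diam H)"
      using le G.pair_finite_verts by (intro sum_strict_mono_ex1) auto
    then show False using eq by simp
  qed
qed

lemma pverts_ne: "pverts G \<noteq> {}" "pverts H \<noteq> {}"
  using G.connected H.connected by (auto simp: connected_def strongly_connected_def)

lemma graph_diam_wreath:
  assumes "card (pverts H) \<ge> 2"
  shows "graph_diam (wreath_product G H) = card (pverts G) * graph_diam H + ham_diam G"
proof (rule antisym)
  have fin: "finite (pverts (wreath_product G H))"
    using finite_states G.pair_finite_verts by simp
  obtain a b where ab: "a \<in> pverts H" "b \<in> pverts H" "geodesic_dist H a b = graph_diam H"
    using graph_diam_attained[OF H.pair_finite_verts pverts_ne(2)] by blast
  obtain u v where uv: "u \<in> pverts G" "v \<in> pverts G" "ham_dist G u v = ham_diam G"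
    using ham_diam_attained[OF G.pair_finite_verts pverts_ne(1)] by blast
  \<comment> \<open>Constant lamp configurations at a diametral pair of \<open>H\<close> maximise
    all lamp distances at once and differ everywhere.\<close>
  let ?f = "\<lambda>w\<in>pverts G. a" and ?f' = "\<lambda>w\<in>pverts G. b"
  have st: "?f \<in> states" "?f' \<in> states" using ab by auto
  have "a \<noteq> b" using ab H.graph_diam_pos[OF assms] by auto
  then have "geodesic_dist (wreath_product G H) (?f, u) (?f', v) =
      card (pverts G) * graph_diam H + ham_diam G"
    using wreath_dist_eq[OF st uv(1,2)] ab(3) uv(3) by simp
  then show "card (pverts G) * graph_diam H + ham_diam G \<le> graph_diam (wreath_product G H)"
    using graph_diam_ge[OF fin, of "(?f, u)" "(?f', v)"] st uv by simp
  have "pverts (wreath_product G H) \<noteq> {}" using st(1) uv(1) unfolding pverts_wreath by blast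
  then obtain g x g' x' where "(g, x) \<in> states \<times> pverts G" "(g', x') \<in> states \<times> pverts G"
      and eq: "geodesic_dist (wreath_product G H) (g, x) (g', x') = graph_diam (wreath_product G H)"
    using graph_diam_attained[OF fin] unfolding pverts_wreath by (metis prod.collapse)
  then have "g \<in> states" "g' \<in> states" "x \<in> pverts G" "x' \<in> pverts G" by auto
  then show "graph_diam (wreath_product G H) \<le> card (pverts G) * graph_diam H + ham_diam G"
    using wreath_dist_le[of g g' x x'] lamp_dist_le[of g g']
      ham_diam_ge[OF G.pair_finite_verts, of x x'] eq by linarith
qed

text \<open>Forwards, the distance is bounded by two summands with separate maxima, so reaching the
  diameter forces both maxima. Backwards, all lamps differ and the exact distance formula
  applies.\<close>

lemma wreath_antipodal_iff:
  assumes "card (pverts H) \<ge> 2"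
    and st: "f \<in> states" "f' \<in> states" "u \<in> pverts G" "v \<in> pverts G"
  shows "geodesic_dist (wreath_product G H) (f, u) (f', v) = graph_diam (wreath_product G H) \<longleftrightarrow>
    (\<forall>w\<in>pverts G. geodesic_dist H (f w) (f' w) = graph_diam H) \<and> ham_dist G u v = ham_diam G"
proof
  assume "geodesic_dist (wreath_product G H) (f, u) (f', v) = graph_diam (wreath_product G H)"
  then have "lamp_dist f f' = card (pverts G) * graph_diam H \<and> ham_dist G u v = ham_diam G"
    using wreath_dist_le[OF st] lamp_dist_le[OF st(1,2)] graph_diam_wreath[OF assms(1)]
      ham_diam_ge[OF G.pair_finite_verts st(3,4)] by linarith
  then show "(\<forall>w\<in>pverts G. geodesic_dist H (f w) (f' w) = graph_diam H) \<and>
      ham_dist G u v = ham_diam G"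
    using lamp_dist_eq_iff[OF st(1,2)] by simp
next
  assume R: "(\<forall>w\<in>pverts G. geodesic_dist H (f w) (f' w) = graph_diam H) \<and>
      ham_dist G u v = ham_diam G"
  have "f w \<noteq> f' w" if "w \<in> pverts G" for w
  proof
    assume "f w = f' w"
    moreover have "f' w \<in> pverts H" using st(2) that by auto
    ultimately show False using R that H.graph_diam_pos[OF assms(1)] by fastforce
  qed
  then show "geodesic_dist (wreath_product G H) (f, u) (f', v) =
      graph_diam (wreath_product G H)"
    using wreath_dist_eq[OF st] graph_diam_wreath[OF assms(1)] R lamp_dist_eq_iff[OF st(1,2)]
    by simp
qed

end

section \<open>Identification of lamp configurations with tuples, and transfer of arcs\<close>

lemma wreath_ident_bij:
  assumes "distinct xs" "set xs = A"
  shows "bij_betw (wreath_ident xs) ((A \<rightarrow>\<^sub>E B) \<times> C)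
    ({ys. length ys = length xs \<and> set ys \<subseteq> B} \<times> C)"
proof -
  have "inj_on (wreath_ident xs) ((A \<rightarrow>\<^sub>E B) \<times> C)"
  proof (intro inj_onI, clarsimp simp: wreath_ident_def)
    fix f g :: "'a \<Rightarrow> 'b" assume "f \<in> A \<rightarrow>\<^sub>E B" "g \<in> A \<rightarrow>\<^sub>E B" "\<forall>x\<in>set xs. f x = g x"
    then show "f = g" using assms(2) by (intro PiE_ext) auto
  qed
  moreover have "(ys, c) \<in> wreath_ident xs ` ((A \<rightarrow>\<^sub>E B) \<times> C)"
    if "length ys = length xs" "set ys \<subseteq> B" "c \<in> C" for ys c
  proof -
    \<comment> \<open>The preimage of \<open>ys\<close> reads off the entry at the index of
      \<open>x\<close> in \<open>xs\<close>, unique by distinctness; \<open>restrict\<close> makes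
      it extensional.\<close>
    define f where "f = restrict (\<lambda>x. the (map_of (zip xs ys) x)) A"
    have nth: "f (xs ! i) = ys ! i" if "i < length xs" for i
      using that assms \<open>length ys = length xs\<close> by (auto simp: f_def map_of_zip_nth)
    then have "map f xs = ys" using that(1) by (intro nth_equalityI) auto
    moreover have "f \<in> A \<rightarrow>\<^sub>E B"
    proof
      fix x assume "x \<in> A"
      then obtain i where "i < length xs" "x = xs ! i" using assms(2) by (metis in_set_conv_nth)
      then show "f x \<in> B" using nth that(1,2) by auto
    qed (simp add: f_def)
    ultimately show ?thesis using that(3) unfolding wreath_ident_def by force
  qed
  ultimately show ?thesis
    using assms(2) by (auto simp: bij_betw_def wreath_ident_def)
qed

theorem theorem4p19:
  fixes G :: "'a pair_pre_digraph" and H :: "'b pair_pre_digraph"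
    and xs :: "'a list" and n :: nat
  assumes "pair_graph G" and "connected G"
    and "pair_graph H" and "connected H"
    and "distinct xs" and "set xs = pverts G" and "length xs = n"
    and "n \<ge> 2" and "card (pverts H) \<ge> 2"
  shows "inj_on (wreath_ident xs) (pverts (antipodal_graph (wreath_product G H))) \<and>
    relabel (wreath_ident xs) (antipodal_graph (wreath_product G H)) =
      direct_product (direct_power (antipodal_graph H) n) (ham_antipodal_graph G)"
proof -
  interpret wreath_factors G H
    using assms(1-4) by (simp add: wreath_factors_def connected_pair_graph_def
        connected_pair_graph_axioms_def)
  let ?h = "wreath_ident xs" and ?V = "states \<times> pverts G"
  let ?T = "{ys. length ys = n \<and> set ys \<subseteq> pverts H}"
  let ?A = "antipodal_graph (wreath_product G H)"
  let ?P = "direct_product (direct_power (antipodal_graph H) n) (ham_antipodal_graph G)"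
  have bij: "bij_betw ?h ?V (?T \<times> pverts G)"
    using wreath_ident_bij[OF assms(5,6), of "pverts H"] assms(7) by simp
  have vA: "pverts ?A = ?V" by (simp add: antipodal_graph_def)
  have vP: "pverts ?P = ?T \<times> pverts G"
    by (simp add: antipodal_graph_def direct_product_def direct_power_def ham_antipodal_graph_def)
  have aA: "parcs ?A \<subseteq> ?V \<times> ?V" by (auto simp: antipodal_graph_def)
  \<comment> \<open>Arcs of the direct power constrain entries by index; their membership in
    \<open>pverts H\<close> comes from the arcs of \<open>antipodal_graph H\<close>.\<close>
  have aP: "parcs ?P \<subseteq> (?T \<times> pverts G) \<times> (?T \<times> pverts G)"
    by (auto simp: antipodal_graph_def direct_product_def direct_power_def
        ham_antipodal_graph_def in_set_conv_nth)
  have arc_iff: "(?h X, ?h Y) \<in> parcs ?P \<longleftrightarrow> (X, Y) \<in> parcs ?A" if "X \<in> ?V" "Y \<in> ?V" for X Y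
  proof -
    obtain f u f' v where XY: "X = (f, u)" "Y = (f', v)" by fastforce
    have st: "f \<in> states" "f' \<in> states" "u \<in> pverts G" "v \<in> pverts G" using that XY by auto
    \<comment> \<open>This turns the condition on all vertices of \<open>G\<close> into the
      coordinatewise condition of the direct power.\<close>
    have all: "(\<forall>w\<in>pverts G. Q w) \<longleftrightarrow> (\<forall>i<n. Q (xs ! i))" for Q
      using assms(6,7) by (metis in_set_conv_nth)
    have mem: "\<forall>i<n. f (xs ! i) \<in> pverts H \<and> f' (xs ! i) \<in> pverts H"
      using st(1,2) all[of "\<lambda>w. f w \<in> pverts H \<and> f' w \<in> pverts H"] by (auto simp: PiE_iff)
    have "(?h X, ?h Y) \<in> parcs ?P \<longleftrightarrow>
        (\<forall>w\<in>pverts G. geodesic_dist H (f w) (f' w) = graph_diam H) \<and> ham_dist G u v = ham_diam G"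
      using mem st(3,4) assms(7)
      by (auto simp: XY wreath_ident_def antipodal_graph_def direct_product_def direct_power_def
          ham_antipodal_graph_def all)
    also have "\<dots> \<longleftrightarrow> (X, Y) \<in> parcs ?A"
      using wreath_antipodal_iff[OF assms(9) st] st by (simp add: XY antipodal_graph_def)
    finally show ?thesis .
  qed
  have arcs: "map_prod ?h ?h ` parcs ?A = parcs ?P"
  proof
    show "map_prod ?h ?h ` parcs ?A \<subseteq> parcs ?P"
      using arc_iff aA by fastforce
    show "parcs ?P \<subseteq> map_prod ?h ?h ` parcs ?A"
    proof
      fix e assume e: "e \<in> parcs ?P"
      \<comment> \<open>Surjectivity of the identification provides preimages of both endpoints, to
        which \<open>arc_iff\<close> applies.\<close>
      then have "fst e \<in> ?h ` ?V" "snd e \<in> ?h ` ?V"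
        using aP bij_betw_imp_surj_on[OF bij] by auto
      then obtain X Y where "X \<in> ?V" "Y \<in> ?V" "fst e = ?h X" "snd e = ?h Y"
        by (elim imageE)
      then have XY: "X \<in> ?V" "Y \<in> ?V" "e = (?h X, ?h Y)" by (simp_all add: prod_eq_iff)
      then have "(X, Y) \<in> parcs ?A" using arc_iff e by blast
      then show "e \<in> map_prod ?h ?h ` parcs ?A" using XY(3) by force
    qed
  qed
  have "relabel ?h ?A = ?P"
    using arcs bij_betw_imp_surj_on[OF bij] vA vP by (simp add: relabel_def)
  then show ?thesis using bij vA by (simp add: bij_betw_def)
qed

end
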